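(* Let $T=\{t_1,\dots,t_M\}\subset\mathbb R^d$ be a finite set and let $(f(t_1),\dots,f(t_M))$ be a multivariate Gaussian vector with $Ef(t_i)=0$ and $\mathrm{Var}(f(t_i))=1$ for each $i$. Let $Q$ and $L_{\sigma,\mu}(b)$ be the measure and importance sampling estimator defined in the context. Then there exist constants $b_0$ and $\kappa_p$, independent of $\sigma(\cdot)$, $\mu(\cdot)$ and $b$, such that for all $b\ge b_0$, $$\frac{E^Q\big(L^2_{\sigma,\mu}(b)\big)}{M^2\,b^6\,w^2_{\sigma,\mu}(b)}\le\kappa_p$$ for all functions $\mu,\sigma$ on $T$ satisfying: for all $s,t\in T$, $\mu(t)\in[\mu_l,\mu_u]$, $\sigma(t)>0$, $\sigma^2(t)\in[\sigma_l^2,\sigma_u^2]$ and $|\sigma(t)-\sigma(s)|+|\mu(t)-\mu(s)|\le\kappa_H|s-t|^\beta$.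
   Context: Fixed constants: $\mu_l\le\mu_u$ in $\mathbb R$, $0<\sigma_l\le\sigma_u<\infty$, $\beta>0$, $\kappa_H>0$, $a>0$; put $\delta_b=a/b$. $w_{\sigma,\mu}(b)=P(\max_{1\le i\le M}\{\sigma(t_i)f(t_i)+\mu(t_i)\}>b)$. $g$ is some positive continuous probability density function on $[\sigma_l,\sigma_u+\delta_b^2]$ and $h$ is some positive continuous probability density function on $[\mu_l,\mu_u+\delta_b]$. The measure $Q$ is given by $$\frac{dQ}{dP}=\int_{\mu_l}^{\mu_u+\delta_b}\int_{\sigma_l}^{\sigma_u+\delta_b^2}\frac{\sum_{i=1}^M I(\varsigma f(t_i)+\nu>b)}{M\,P(\varsigma f(t_1)+\nu>b)}\,g(\varsigma)h(\nu)\,d\varsigma\,d\nu,$$ where $P$ is the law of $(f(t_1),\dots,f(t_M))$. (Equivalently, under $Q$: draw $\varsigma\sim g$, $\nu\sim h$ and $\tau$ uniform on $T$, independently; draw $f(\tau)$ from its $P$-law conditioned on $\varsigma f(\tau)+\nu>b$; draw the remaining coordinates from their $P$-conditional law given $f(\tau)$.) The estimator is $$L_{\sigma,\mu}(b)=\Big(\frac{dQ}{dP}\Big)^{-1} I\Big(\max_{1\le i\le M}\{\sigma(t_i)f(t_i)+\mu(t_i)\}>b\Big),$$ interpreted as $0$ when the indicator is $0$. $E^Q$ is expectation under $Q$.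
   Formalization: The densities g and h live on intervals depending on b, so they are families g_b, h_b; they are assumed bounded below by a positive constant on their intervals for all large b. Without such uniformity in b the claim fails, e.g. if g_b concentrates near σ_u while σ ≡ σ_l < σ_u. *)

theory Defs
  imports "HOL-Probability.Probability"
begin

(* Standard deviation 0 is allowed: Gaussian vectors may have a singular covariance matrix. *)
definition gaussian_law :: "real \<Rightarrow> real \<Rightarrow> real measure" where
  "gaussian_law m s =
     (if s = 0 then return borel m else density lborel (\<lambda>x. ennreal (normal_density m s x)))"

definition gaussian_vector :: "'w measure \<Rightarrow> 'i set \<Rightarrow> ('i \<Rightarrow> 'w \<Rightarrow> real) \<Rightarrow> bool" where
  "gaussian_vector W I X \<longleftrightarrow>
     prob_space W \<and> finite I \<and> (\<forall>i\<in>I. X i \<in> borel_measurable W) \<and>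
     (\<forall>c :: 'i \<Rightarrow> real. \<exists>m s. 0 \<le> s \<and>
        distr W borel (\<lambda>\<omega>. \<Sum>i\<in>I. c i * X i \<omega>) = gaussian_law m s)"

definition field_law ::
    "'w measure \<Rightarrow> (real ^ 'd \<Rightarrow> 'w \<Rightarrow> real) \<Rightarrow> (nat \<Rightarrow> real ^ 'd) \<Rightarrow> nat \<Rightarrow> (nat \<Rightarrow> real) measure"
  where
  "field_law W f t M =
     distr W (\<Pi>\<^sub>M i\<in>{1..M}. (borel :: real measure)) (\<lambda>\<omega>. \<lambda>i\<in>{1..M}. f (t i) \<omega>)"

(* Below, P is the law of (f(t_1),...,f(t_M)) on R^{1..M}; a sample x has x i = f(t_i). *)

definition exceeds ::
    "nat \<Rightarrow> (nat \<Rightarrow> real ^ 'd) \<Rightarrow> (real ^ 'd \<Rightarrow> real) \<Rightarrow> (real ^ 'd \<Rightarrow> real) \<Rightarrow> real \<Rightarrow> (nat \<Rightarrow> real) \<Rightarrow> bool"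
  where
  "exceeds M t \<sigma> \<mu> b x \<longleftrightarrow> (MAX i\<in>{1..M}. \<sigma> (t i) * x i + \<mu> (t i)) > b"

definition tail_prob ::
    "(nat \<Rightarrow> real) measure \<Rightarrow> nat \<Rightarrow> (nat \<Rightarrow> real ^ 'd) \<Rightarrow>
     (real ^ 'd \<Rightarrow> real) \<Rightarrow> (real ^ 'd \<Rightarrow> real) \<Rightarrow> real \<Rightarrow> real"
  where
  "tail_prob P M t \<sigma> \<mu> b = measure P {x \<in> space P. exceeds M t \<sigma> \<mu> b x}"

(* The mixing densities g and h live on intervals that shrink as b grows, so they are families
   indexed by the level b.  A bound that is uniform in b needs them to stay away from 0 as b tends
   to infinity; pos_cont_density says nothing about that, it concerns one b at a time. *)
definition pos_cont_density :: "real \<Rightarrow> real \<Rightarrow> (real \<Rightarrow> real) \<Rightarrow> bool" where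
  "pos_cont_density l u \<phi> \<longleftrightarrow>
     continuous_on {l..u} \<phi> \<and> (\<forall>x\<in>{l..u}. 0 < \<phi> x) \<and>
     (\<integral>\<^sup>+x\<in>{l..u}. ennreal (\<phi> x) \<partial>lborel) = 1"

definition dQdP ::
    "(nat \<Rightarrow> real) measure \<Rightarrow> nat \<Rightarrow> real \<Rightarrow> real \<Rightarrow> real \<Rightarrow> real \<Rightarrow> real \<Rightarrow>
     (real \<Rightarrow> real \<Rightarrow> real) \<Rightarrow> (real \<Rightarrow> real \<Rightarrow> real) \<Rightarrow> real \<Rightarrow> (nat \<Rightarrow> real) \<Rightarrow> ennreal"
  where
  "dQdP P M \<mu>\<^sub>l \<mu>\<^sub>u \<sigma>\<^sub>l \<sigma>\<^sub>u a g h b x =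
     (\<integral>\<^sup>+\<nu>\<in>{\<mu>\<^sub>l..\<mu>\<^sub>u + a / b}. (\<integral>\<^sup>+\<zeta>\<in>{\<sigma>\<^sub>l..\<sigma>\<^sub>u + (a / b)\<^sup>2}.
        ennreal ((\<Sum>i=1..M. of_bool (\<zeta> * x i + \<nu> > b))
                 / (real M * measure P {y \<in> space P. \<zeta> * y 1 + \<nu> > b})
                 * g b \<zeta> * h b \<nu>) \<partial>lborel) \<partial>lborel)"

definition estimator ::
    "((nat \<Rightarrow> real) \<Rightarrow> ennreal) \<Rightarrow> nat \<Rightarrow> (nat \<Rightarrow> real ^ 'd) \<Rightarrow>
     (real ^ 'd \<Rightarrow> real) \<Rightarrow> (real ^ 'd \<Rightarrow> real) \<Rightarrow> real \<Rightarrow> (nat \<Rightarrow> real) \<Rightarrow> ennreal"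
  where
  "estimator D M t \<sigma> \<mu> b x = (if exceeds M t \<sigma> \<mu> b x then inverse (D x) else 0)"

definition admissible ::
    "real \<Rightarrow> real \<Rightarrow> real \<Rightarrow> real \<Rightarrow> real \<Rightarrow> real \<Rightarrow> (real ^ 'd) set \<Rightarrow>
     (real ^ 'd \<Rightarrow> real) \<Rightarrow> (real ^ 'd \<Rightarrow> real) \<Rightarrow> bool"
  where
  "admissible \<mu>\<^sub>l \<mu>\<^sub>u \<sigma>\<^sub>l \<sigma>\<^sub>u \<kappa>\<^sub>H \<beta> T \<sigma> \<mu> \<longleftrightarrow>
     (\<forall>p\<in>T. \<mu> p \<in> {\<mu>\<^sub>l..\<mu>\<^sub>u} \<and> 0 < \<sigma> p \<and> (\<sigma> p)\<^sup>2 \<in> {\<sigma>\<^sub>l\<^sup>2..\<sigma>\<^sub>u\<^sup>2}) \<and>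
     (\<forall>p\<in>T. \<forall>q\<in>T. \<bar>\<sigma> p - \<sigma> q\<bar> + \<bar>\<mu> p - \<mu> q\<bar> \<le> \<kappa>\<^sub>H * norm (p - q) powr \<beta>)"

end

theory Submission
  imports Defs
begin

text \<open>
  Since \<open>E\<^sup>Q L\<^sup>2\<close> is the \<open>P\<close>-integral of \<open>1 / (dQ/dP)\<close> over the exceedance event, whose
  \<open>P\<close>-probability is \<open>w\<close>, it suffices to bound \<open>dQ/dP\<close> from below on that event by a multiple of
  \<open>1 / (M b\<^sup>3 w)\<close>. If \<open>\<sigma>(t\<^sub>i) x\<^sub>i + \<mu>(t\<^sub>i) > b\<close>, the mixture over the box
  \<open>[\<sigma>(t\<^sub>i), \<sigma>(t\<^sub>i) + a\<^sup>2/b\<^sup>2] \<times> [\<mu>(t\<^sub>i), \<mu>(t\<^sub>i) + a/b]\<close>, of area \<open>a\<^sup>3/b\<^sup>3\<close>, is enough: perturbing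
  \<open>(\<sigma>, \<mu>)\<close> within it moves the standardised level \<open>(b - \<mu>)/\<sigma>\<close>, which is of order \<open>b\<close>, by at most
  \<open>O(1/b)\<close>, and so inflates the Gaussian tail at that level, itself at most \<open>w\<close>, by a bounded
  factor only.
\<close>

section \<open>Tail estimates for the standard normal law\<close>

abbreviation std_normal :: "real measure" where
  "std_normal \<equiv> density lborel (\<lambda>x. ennreal (std_normal_density x))"

lemma std_normal_density_antimono:
  assumes "0 \<le> u" "u \<le> v"
  shows "std_normal_density v \<le> std_normal_density u"
  using assms power_mono[of u v 2] by (simp add: std_normal_density_def divide_right_mono)

lemma prob_space_std_normal: "prob_space std_normal"
  by (rule prob_space_normal_density) simp

text \<open>The density decreases on the nonnegative half-line, so its endpoint values bound the
  integrand. The two halves serve adjacent intervals in the shift estimate below.\<close>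

lemma std_normal_interval_bounds:
  assumes "0 \<le> u" "u \<le> v"
  shows "(v - u) * std_normal_density v \<le> measure std_normal {u<..v}"
    and "measure std_normal {u<..v} \<le> (v - u) * std_normal_density u"
proof -
  interpret prob_space std_normal by (rule prob_space_std_normal)
  have em: "ennreal (measure std_normal {u<..v}) =
      (\<integral>\<^sup>+x. ennreal (std_normal_density x) * indicator {u<..v} x \<partial>lborel)"
    by (simp add: emeasure_eq_measure[symmetric] emeasure_density)
  have const: "ennreal ((v - u) * std_normal_density c) =
      (\<integral>\<^sup>+x. ennreal (std_normal_density c) * indicator {u<..v} x \<partial>lborel)" for c
    using assms by (simp add: nn_integral_cmult_indicator ennreal_mult' mult.commute)
  have "ennreal ((v - u) * std_normal_density v) \<le> ennreal (measure std_normal {u<..v})"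
    unfolding em const
    using assms by (intro nn_integral_mono) (auto split: split_indicator intro!: ennreal_leI std_normal_density_antimono)
  then show "(v - u) * std_normal_density v \<le> measure std_normal {u<..v}"
    by simp
  have "ennreal (measure std_normal {u<..v}) \<le> ennreal ((v - u) * std_normal_density u)"
    unfolding em const
    using assms by (intro nn_integral_mono) (auto split: split_indicator intro!: ennreal_leI std_normal_density_antimono)
  then show "measure std_normal {u<..v} \<le> (v - u) * std_normal_density u"
    using assms by (simp add: ennreal_le_iff)
qed

lemma std_normal_tail_antimono:
  "u \<le> v \<Longrightarrow> measure std_normal {v<..} \<le> measure std_normal {u<..}"
  using prob_space_std_normal
  by (intro finite_measure.finite_measure_mono) (auto simp: prob_space_def)

text \<open>Passing to \<open>\<bar>z\<bar>\<close> puts a unit interval inside the tail where the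
  density is monotone. Positivity is needed for the normalising probabilities and for
  \<open>w\<close>.\<close>

lemma std_normal_tail_pos: "0 < measure std_normal {z<..}"
proof -
  interpret prob_space std_normal by (rule prob_space_std_normal)
  have "0 < (\<bar>z\<bar> + 1 - \<bar>z\<bar>) * std_normal_density (\<bar>z\<bar> + 1)"
    by (simp add: normal_density_pos)
  also have "\<dots> \<le> measure std_normal {\<bar>z\<bar><..\<bar>z\<bar> + 1}"
    by (rule std_normal_interval_bounds) auto
  also have "\<dots> \<le> measure std_normal {z<..}"
    by (rule finite_measure_mono) auto
  finally show ?thesis .
qed

text \<open>
  The mass of \<open>{z - \<delta><..z}\<close> is at most \<open>exp (2 \<delta> z)\<close> times that of \<open>{z<..z + \<delta>}\<close>, because the
  density at \<open>z - \<delta>\<close> is exactly \<open>exp (2 \<delta> z)\<close> times the density at \<open>z + \<delta>\<close>.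
\<close>

lemma std_normal_tail_shift:
  assumes "0 \<le> \<delta>" "\<delta> \<le> z" "\<delta> * z \<le> K"
  shows "measure std_normal {z - \<delta><..} \<le> (1 + exp (2 * K)) * measure std_normal {z<..}"
proof -
  interpret prob_space std_normal by (rule prob_space_std_normal)
  have "measure std_normal {z - \<delta><..z} \<le> \<delta> * std_normal_density (z - \<delta>)"
    using std_normal_interval_bounds(2)[of "z - \<delta>" z] assms by simp
  also have "std_normal_density (z - \<delta>) = exp (2 * (\<delta> * z)) * std_normal_density (z + \<delta>)"
    by (simp add: std_normal_density_def exp_add[symmetric] power2_eq_square field_simps)
  also have "\<delta> * \<dots> \<le> exp (2 * K) * (\<delta> * std_normal_density (z + \<delta>))"
    using assms mult_right_mono[of "exp (2 * (\<delta> * z))" "exp (2 * K)" "\<delta> * std_normal_density (z + \<delta>)"]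
    by (simp add: mult_ac)
  also have "\<delta> * std_normal_density (z + \<delta>) \<le> measure std_normal {z<..z + \<delta>}"
    using std_normal_interval_bounds(1)[of z "z + \<delta>"] assms by simp
  also have "measure std_normal {z<..z + \<delta>} \<le> measure std_normal {z<..}"
    by (rule finite_measure_mono) auto
  finally have "measure std_normal {z - \<delta><..z} \<le> exp (2 * K) * measure std_normal {z<..}"
    by simp
  moreover have "{z - \<delta><..} = {z - \<delta><..z} \<union> {z<..}"
    using assms by auto
  then have "measure std_normal {z - \<delta><..} = measure std_normal {z - \<delta><..z} + measure std_normal {z<..}"
    by (simp add: finite_measure_Union disjoint_iff)
  ultimately show ?thesis
    by (simp add: algebra_simps)
qed

text \<open>Writing b = z \<sigma> + \<mu>, the quantity z \<zeta> - (b - \<nu>) equals (\<zeta> -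
  \<sigma>) z + (\<nu> - \<mu>). It is at most (K / b) \<zeta>, so the level drops by at most K / b.
  Since z is at most 2 b / s, the shift lemma applies with \<delta> = K / b and \<delta> z bounded
  by 2 K / s.\<close>

lemma std_normal_tail_perturbed:
  assumes "0 < s" "s \<le> \<sigma>" "\<sigma> \<le> S" "0 < a" "1 \<le> b" "\<bar>\<mu>\<bar> \<le> b"
    and K: "K = 2 * a\<^sup>2 / s\<^sup>2 + a / s"
    and b: "S * K + \<mu> \<le> b"
    and \<zeta>: "\<sigma> \<le> \<zeta>" "\<zeta> \<le> \<sigma> + (a / b)\<^sup>2" and \<nu>: "\<nu> \<le> \<mu> + a / b"
  shows "measure std_normal {(b - \<nu>) / \<zeta><..}
    \<le> (1 + exp (4 * K / s)) * measure std_normal {(b - \<mu>) / \<sigma><..}"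
proof -
  define z where "z = (b - \<mu>) / \<sigma>"
  have pos: "0 < \<sigma>" "0 < \<zeta>" "0 < b" "0 < K" "0 < S"
    using assms by (auto simp: K intro!: add_pos_pos)
  have bz: "z * \<sigma> = b - \<mu>" "0 \<le> z"
    using pos assms by (auto simp: z_def)
  have z_le: "z \<le> 2 * b / s"
    unfolding z_def using assms pos by (intro frac_le) auto
  \<comment> \<open>The two summands of \<open>K\<close> pay for the two perturbations: 2 a^2 / s^2
    for \<zeta> and a / s for \<nu>.\<close>
  have "K / b * \<zeta> \<ge> (\<zeta> - \<sigma>) * z + a / b"
  proof -
    have "(\<zeta> - \<sigma>) * z \<le> (a / b)\<^sup>2 * (2 * b / s)"
      using \<zeta> z_le bz by (intro mult_mono) auto
    also have "\<dots> = 2 * a\<^sup>2 / (s * b)"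
      using pos assms by (simp add: field_simps power2_eq_square)
    finally have "(\<zeta> - \<sigma>) * z + a / b \<le> 2 * a\<^sup>2 / (s * b) + a / b" by simp
    also have "\<dots> = K / b * s"
      using pos assms by (simp add: K field_simps power2_eq_square)
    also have "\<dots> \<le> K / b * \<zeta>"
      using pos assms by (intro mult_left_mono) auto
    finally show ?thesis .
  qed
  then have "(z - K / b) * \<zeta> \<le> b - \<nu>"
    using bz \<nu> by (simp add: algebra_simps)
  then have "z - K / b \<le> (b - \<nu>) / \<zeta>"
    using pos by (simp add: pos_le_divide_eq)
  then have "measure std_normal {(b - \<nu>) / \<zeta><..} \<le> measure std_normal {z - K / b<..}"
    by (rule std_normal_tail_antimono)
  also have "\<dots> \<le> (1 + exp (2 * (2 * K / s))) * measure std_normal {z<..}"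
  proof (rule std_normal_tail_shift)
    \<comment> \<open>The largeness condition \<open>b\<close> gives K \<le> z; hence the shifted
      level z - K / b stays nonnegative, where the density is monotone.\<close>
    have "K / b \<le> K"
      using pos \<open>1 \<le> b\<close> mult_left_mono[of 1 b K] by (simp add: pos_divide_le_eq)
    also have "K * \<sigma> \<le> b - \<mu>"
      using b mult_right_mono[of \<sigma> S K] pos assms by (simp add: algebra_simps)
    then have "K \<le> z"
      using pos by (simp add: z_def field_simps)
    finally show "K / b \<le> z" .
    have "K / b * z \<le> K / b * (2 * b / s)"
      using z_le pos by (intro mult_left_mono) auto
    then show "K / b * z \<le> 2 * K / s"
      using pos by (simp add: field_simps)
  qed (use pos in simp)
  finally show ?thesis
    by (simp add: z_def)
qed

section \<open>Standard normal marginals of the Gaussian vector\<close>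

lemma gaussian_law_standard:
  assumes "0 \<le> s"
    and "(\<integral>x. x \<partial>gaussian_law m s) = 0"
    and "(\<integral>x. x\<^sup>2 \<partial>gaussian_law m s) = 1"
  shows "gaussian_law m s = std_normal"
proof (cases "s = 0")
  \<comment> \<open>A point mass with mean 0 sits at 0, so its second moment is 0 rather than
    1.\<close>
  case True
  then show ?thesis
    using assms by (simp add: gaussian_law_def integral_return)
next
  case False
  then have s: "0 < s" using assms by simp
  have law: "gaussian_law m s = density lborel (\<lambda>x. ennreal (normal_density m s x))"
    using s by (simp add: gaussian_law_def)
  have m: "m = 0"
    using assms(2) s by (simp add: law integral_density integral_normal_moment_nz_1)
  have "has_bochner_integral lborel (\<lambda>x. normal_density 0 s x * x\<^sup>2) (s\<^sup>2)"
    using normal_moment_even[OF s, of 0 1] by (simp add: fact_2)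
  then have "s\<^sup>2 = 1"
    using assms(3) unfolding law unfolding m by (simp add: integral_density has_bochner_integral_integral_eq)
  then have "s = 1"
    using s by (simp add: power2_eq_1_iff)
  then show ?thesis
    using law m by simp
qed

text \<open>A single coordinate is the linear combination with coefficients
  \<open>of_bool (j = i)\<close>. As the mean is 0, the variance is the second moment.\<close>

lemma gaussian_vector_marginal:
  assumes "gaussian_vector W I X" "i \<in> I"
    and "prob_space.expectation W (X i) = 0" "prob_space.variance W (X i) = 1"
  shows "distr W borel (X i) = std_normal"
proof -
  have fin: "finite I" and X[measurable]: "X i \<in> borel_measurable W"
    using assms by (auto simp: gaussian_vector_def)
  have "\<exists>m s. 0 \<le> s \<and> distr W borel (\<lambda>\<omega>. \<Sum>j\<in>I. of_bool (j = i) * X j \<omega>) = gaussian_law m s"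
    using assms(1) unfolding gaussian_vector_def by (elim conjE) (erule allE)
  then obtain m s where s: "0 \<le> s"
    and law: "distr W borel (\<lambda>\<omega>. \<Sum>j\<in>I. of_bool (j = i) * X j \<omega>) = gaussian_law m s"
    by auto
  have law': "distr W borel (X i) = gaussian_law m s"
    using law fin assms(2) by (simp add: if_distrib if_distribR of_bool_def cong: if_cong)
  have "gaussian_law m s = std_normal"
  proof (rule gaussian_law_standard[OF s])
    show "(\<integral>x. x \<partial>gaussian_law m s) = 0"
      using assms(3) by (simp add: law'[symmetric] integral_distr)
    show "(\<integral>x. x\<^sup>2 \<partial>gaussian_law m s) = 1"
      using assms(3,4) by (simp add: law'[symmetric] integral_distr)
  qed
  then show ?thesis
    using law' by simp
qed

lemma prob_space_field_law:
  assumes "prob_space W" "\<And>i. i \<in> {1..M} \<Longrightarrow> f (t i) \<in> borel_measurable W"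
  shows "prob_space (field_law W f t M)"
  unfolding field_law_def using assms
  by (intro prob_space.prob_space_distr) (auto intro!: measurable_restrict)

text \<open>The right-hand side does not depend on \<open>i\<close>. This lets the normaliser of
  \<open>dQdP\<close>, taken at coordinate 1, be compared with an exceedance at any other
  coordinate.\<close>

lemma measure_field_law_tail:
  assumes meas: "\<And>i. i \<in> {1..M} \<Longrightarrow> f (t i) \<in> borel_measurable W"
    and i: "i \<in> {1..M}" and law: "distr W borel (f (t i)) = std_normal" and "0 < \<zeta>"
  shows "measure (field_law W f t M) {y \<in> space (field_law W f t M). b < \<zeta> * y i + \<nu>}
    = measure std_normal {(b - \<nu>) / \<zeta><..}"
proof -
  let ?P = "field_law W f t M"
  have [measurable]: "(\<lambda>\<omega>. \<lambda>i\<in>{1..M}. f (t i) \<omega>) \<in> W \<rightarrow>\<^sub>M (\<Pi>\<^sub>M i\<in>{1..M}. borel)"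
    using meas by (auto intro!: measurable_restrict)
  have coord: "(\<lambda>y. y i) \<in> ?P \<rightarrow>\<^sub>M borel"
    using i by (simp add: field_law_def)
  have "distr ?P borel (\<lambda>y. y i) = distr W borel (\<lambda>\<omega>. (\<lambda>i\<in>{1..M}. f (t i) \<omega>) i)"
    unfolding field_law_def using i
    by (subst distr_distr[OF measurable_component_singleton]) (simp_all add: comp_def del: One_nat_def)
  also have "\<dots> = distr W borel (f (t i))"
    using i by simp
  finally have "distr ?P borel (\<lambda>y. y i) = distr W borel (f (t i))" .
  then have "measure std_normal {(b - \<nu>) / \<zeta><..} =
      measure ?P ((\<lambda>y. y i) -` {(b - \<nu>) / \<zeta><..} \<inter> space ?P)"
    unfolding law[symmetric] by (metis coord measure_distr greaterThan_borel)
  also have "(\<lambda>y. y i) -` {(b - \<nu>) / \<zeta><..} \<inter> space ?P = {y \<in> space ?P. b < \<zeta> * y i + \<nu>}"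
    using \<open>0 < \<zeta>\<close> by (auto simp: field_simps)
  finally show ?thesis by simp
qed

section \<open>The mixture density dQ/dP and the second moment of the estimator\<close>

lemma exceeds_iff:
  "1 \<le> M \<Longrightarrow> exceeds M t \<sigma> \<mu> b x \<longleftrightarrow> (\<exists>i\<in>{1..M}. b < \<sigma> (t i) * x i + \<mu> (t i))"
  by (auto simp: exceeds_def Max_gr_iff)

lemma borel_measurable_dQdP:
  fixes P :: "(nat \<Rightarrow> real) measure"
  assumes "finite_measure P" and sets_P: "sets P = sets (\<Pi>\<^sub>M i\<in>{1..M}. borel)" and "1 \<le> M"
    and g: "pos_cont_density \<sigma>\<^sub>l (\<sigma>\<^sub>u + (a / b)\<^sup>2) (g b)"
    and h: "pos_cont_density \<mu>\<^sub>l (\<mu>\<^sub>u + a / b) (h b)"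
  shows "dQdP P M \<mu>\<^sub>l \<mu>\<^sub>u \<sigma>\<^sub>l \<sigma>\<^sub>u a g h b \<in> borel_measurable P"
proof -
  interpret finite_measure P by fact
  define g' where "g' \<zeta> = indicator {\<sigma>\<^sub>l..\<sigma>\<^sub>u + (a / b)\<^sup>2} \<zeta> *\<^sub>R g b \<zeta>" for \<zeta>
  define h' where "h' \<nu> = indicator {\<mu>\<^sub>l..\<mu>\<^sub>u + a / b} \<nu> *\<^sub>R h b \<nu>" for \<nu>
  have [measurable]: "g' \<in> borel_measurable borel" "h' \<in> borel_measurable borel"
    using g h unfolding pos_cont_density_def g'_def[abs_def] h'_def[abs_def]
    by (auto intro!: borel_measurable_continuous_on_indicator simp del: scaleR_conv_of_real real_scaleR_def)
  have coord[measurable]: "(\<lambda>x. x i) \<in> borel_measurable P" if "i \<in> {1..M}" for i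
    using measurable_component_singleton[OF that] by (simp cong: measurable_cong_sets add: sets_P)
  have coord1[measurable]: "(\<lambda>x. x 1) \<in> borel_measurable P" "(\<lambda>x. x (Suc 0)) \<in> borel_measurable P"
    using coord[of 1] \<open>1 \<le> M\<close> by auto
  \<comment> \<open>The densities are measurable only on their intervals, so the indicators move inside.\<close>
  have eq: "dQdP P M \<mu>\<^sub>l \<mu>\<^sub>u \<sigma>\<^sub>l \<sigma>\<^sub>u a g h b x =
      (\<integral>\<^sup>+\<nu>. (\<integral>\<^sup>+\<zeta>. ennreal ((\<Sum>i=1..M. of_bool (\<zeta> * x i + \<nu> > b))
         / (real M * measure P {y \<in> space P. \<zeta> * y 1 + \<nu> > b}) * g' \<zeta> * h' \<nu>) \<partial>lborel) \<partial>lborel)" for x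
    unfolding dQdP_def
    by (intro nn_integral_cong) (auto simp: g'_def h'_def intro!: nn_integral_cong split: split_indicator)
  show ?thesis
    \<comment> \<open>The normaliser varies with \<zeta> and \<nu>; unfolded to
      \<open>emeasure P\<close> of sections of a jointly measurable event, it is measurable in them
      because \<open>P\<close> is finite.\<close>
    unfolding eq measure_def by measurable
qed

text \<open>The enlarged parameter ranges contain the whole box with lower corner (s, m). As
  \<open>x i\<close> is nonnegative, moving up in the box keeps coordinate \<open>i\<close> above
  \<open>b\<close>, so the sum of indicators is at least 1. The integrand is then at least c, and
  the box has area (a / b)^3.\<close>

lemma dQdP_lower_bound:
  assumes "1 \<le> M" "0 < a" "0 < b" "0 \<le> c\<^sub>g" "0 \<le> c\<^sub>h" "0 < B"
    and i: "i \<in> {1..M}" "0 \<le> x i" "b < s * x i + m"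
    and s: "\<sigma>\<^sub>l \<le> s" "s \<le> \<sigma>\<^sub>u" and m: "\<mu>\<^sub>l \<le> m" "m \<le> \<mu>\<^sub>u"
    and g: "\<And>\<zeta>. \<zeta> \<in> {\<sigma>\<^sub>l..\<sigma>\<^sub>u + (a / b)\<^sup>2} \<Longrightarrow> c\<^sub>g \<le> g b \<zeta>"
    and h: "\<And>\<nu>. \<nu> \<in> {\<mu>\<^sub>l..\<mu>\<^sub>u + a / b} \<Longrightarrow> c\<^sub>h \<le> h b \<nu>"
    and p: "\<And>\<zeta> \<nu>. \<zeta> \<in> {s..s + (a / b)\<^sup>2} \<Longrightarrow> \<nu> \<in> {m..m + a / b} \<Longrightarrow>
        measure P {y \<in> space P. \<zeta> * y 1 + \<nu> > b} \<in> {0<..B}"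
  shows "ennreal (c\<^sub>g * c\<^sub>h * (a / b) ^ 3 / (real M * B)) \<le> dQdP P M \<mu>\<^sub>l \<mu>\<^sub>u \<sigma>\<^sub>l \<sigma>\<^sub>u a g h b x"
proof -
  define c where "c = c\<^sub>g * c\<^sub>h / (real M * B)"
  have "0 \<le> c" using assms by (simp add: c_def)
  have "ennreal (c\<^sub>g * c\<^sub>h * (a / b) ^ 3 / (real M * B)) = ennreal (c * (a / b)\<^sup>2 * (a / b))"
    by (simp add: c_def power3_eq_cube power2_eq_square mult_ac)
  also have "\<dots> = (\<integral>\<^sup>+\<nu>\<in>{m..m + a / b}. (\<integral>\<^sup>+\<zeta>\<in>{s..s + (a / b)\<^sup>2}. ennreal c \<partial>lborel) \<partial>lborel)"
  proof -
    have "(\<integral>\<^sup>+\<zeta>\<in>{s..s + (a / b)\<^sup>2}. ennreal c \<partial>lborel) = ennreal (c * (a / b)\<^sup>2)"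
      using \<open>0 \<le> c\<close> by (simp add: nn_integral_cmult_indicator ennreal_mult)
    then show ?thesis
      using \<open>0 \<le> c\<close> \<open>0 < a\<close> \<open>0 < b\<close>
      by (simp add: nn_integral_cmult_indicator ennreal_mult del: power_divide times_divide_eq_right)
  qed
  also have "\<dots> \<le> dQdP P M \<mu>\<^sub>l \<mu>\<^sub>u \<sigma>\<^sub>l \<sigma>\<^sub>u a g h b x"
    unfolding dQdP_def
  proof (intro nn_integral_mono)
    fix \<nu> :: real
    let ?D = "\<lambda>\<zeta>. ennreal ((\<Sum>i=1..M. of_bool (\<zeta> * x i + \<nu> > b))
                 / (real M * measure P {y \<in> space P. \<zeta> * y 1 + \<nu> > b}) * g b \<zeta> * h b \<nu>)"
    have "ennreal c * indicator {s..s + (a / b)\<^sup>2} \<zeta> \<le> ?D \<zeta> * indicator {\<sigma>\<^sub>l..\<sigma>\<^sub>u + (a / b)\<^sup>2} \<zeta>"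
      if \<nu>: "\<nu> \<in> {m..m + a / b}" for \<zeta>
    proof (cases "\<zeta> \<in> {s..s + (a / b)\<^sup>2}")
      case \<zeta>: True
      let ?S = "\<Sum>i=1..M. of_bool (\<zeta> * x i + \<nu> > b) :: real"
      let ?p = "measure P {y \<in> space P. \<zeta> * y 1 + \<nu> > b}"
      have g\<zeta>: "c\<^sub>g \<le> g b \<zeta>" using g \<zeta> s by simp
      have h\<nu>: "c\<^sub>h \<le> h b \<nu>" using h \<nu> m by simp
      have "s * x i + m \<le> \<zeta> * x i + \<nu>"
        using \<zeta> \<nu> i by (intro add_mono mult_right_mono) auto
      then have "(1::real) \<le> of_bool (\<zeta> * x i + \<nu> > b)"
        using i by simp
      also have "\<dots> \<le> ?S"
        using i by (intro member_le_sum) auto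
      finally have "1 \<le> ?S" .
      \<comment> \<open>Positivity of \<open>?p\<close> matters as much as the bound
        \<open>B\<close>: division by 0 would make the right-hand side 0.\<close>
      have "1 / (real M * B) \<le> ?S / (real M * ?p)"
        using \<open>1 \<le> ?S\<close> p[OF \<zeta> \<nu>] \<open>1 \<le> M\<close> by (intro frac_le mult_left_mono) auto
      then have "1 / (real M * B) * c\<^sub>g * c\<^sub>h \<le> ?S / (real M * ?p) * g b \<zeta> * h b \<nu>"
        using g\<zeta> h\<nu> assms by (intro mult_mono) (auto intro!: mult_nonneg_nonneg divide_nonneg_nonneg sum_nonneg)
      then have "c \<le> ?S / (real M * ?p) * g b \<zeta> * h b \<nu>"
        by (simp add: c_def)
      then show ?thesis
        using \<zeta> s by (simp add: ennreal_leI)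
    qed simp
    then show "(\<integral>\<^sup>+\<zeta>\<in>{s..s + (a / b)\<^sup>2}. ennreal c \<partial>lborel) * indicator {m..m + a / b} \<nu>
      \<le> (\<integral>\<^sup>+\<zeta>\<in>{\<sigma>\<^sub>l..\<sigma>\<^sub>u + (a / b)\<^sup>2}. ?D \<zeta> \<partial>lborel) * indicator {\<mu>\<^sub>l..\<mu>\<^sub>u + a / b} \<nu>"
      using m by (auto split: split_indicator intro!: nn_integral_mono)
  qed
  finally show ?thesis .
qed

text \<open>Under \<open>P\<close> the integrand becomes D times D^(-2) on the event, which is at
  most 1 / D and hence at most 1 / c.\<close>

lemma second_moment_bound:
  assumes D[measurable]: "D \<in> borel_measurable P" and "1 \<le> M" "0 < c"
    and coord: "\<And>i. i \<in> {1..M} \<Longrightarrow> (\<lambda>x. x i) \<in> borel_measurable P"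
    and low: "\<And>x. exceeds M t \<sigma> \<mu> b x \<Longrightarrow> ennreal c \<le> D x"
    and "finite_measure P"
  shows "(\<integral>\<^sup>+x. (estimator D M t \<sigma> \<mu> b x)\<^sup>2 \<partial>density P D) \<le> ennreal (tail_prob P M t \<sigma> \<mu> b / c)"
proof -
  interpret finite_measure P by fact
  have [measurable]: "Measurable.pred P (exceeds M t \<sigma> \<mu> b)"
    unfolding exceeds_iff[OF \<open>1 \<le> M\<close>] using coord by measurable
  have "(\<integral>\<^sup>+x. (estimator D M t \<sigma> \<mu> b x)\<^sup>2 \<partial>density P D)
      = (\<integral>\<^sup>+x. D x * (estimator D M t \<sigma> \<mu> b x)\<^sup>2 \<partial>P)"
    unfolding estimator_def by (intro nn_integral_density) measurable
  also have "\<dots> \<le> (\<integral>\<^sup>+x. ennreal (1 / c) * indicator {x \<in> space P. exceeds M t \<sigma> \<mu> b x} x \<partial>P)"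
  proof (intro nn_integral_mono)
    fix x assume x: "x \<in> space P"
    show "D x * (estimator D M t \<sigma> \<mu> b x)\<^sup>2
      \<le> ennreal (1 / c) * indicator {x \<in> space P. exceeds M t \<sigma> \<mu> b x} x"
    proof (cases "exceeds M t \<sigma> \<mu> b x")
      case True
      have "D x * (inverse (D x))\<^sup>2 = D x * inverse (D x) * inverse (D x)"
        by (simp add: power2_eq_square mult.assoc)
      \<comment> \<open>Only an inequality: in \<open>ennreal\<close> the product is 0 when
        \<open>D x\<close> is 0 or infinite.\<close>
      also have "D x * inverse (D x) \<le> 1"
        by (cases "D x = 0 \<or> D x = \<top>") (auto simp: ennreal_divide_self divide_ennreal_def[symmetric] less_top)
      then have "D x * inverse (D x) * inverse (D x) \<le> 1 * inverse (D x)"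
        by (rule mult_right_mono) simp
      also have "\<dots> \<le> ennreal (1 / c)"
        using low[OF True] \<open>0 < c\<close>
        by (cases "D x") (auto simp: inverse_ennreal ennreal_le_iff2 inverse_eq_divide frac_le intro!: ennreal_leI)
      finally show ?thesis
        using True x by (simp add: estimator_def)
    qed (simp add: estimator_def)
  qed
  also have "\<dots> = ennreal (1 / c) * emeasure P {x \<in> space P. exceeds M t \<sigma> \<mu> b x}"
    by (rule nn_integral_cmult_indicator) measurable
  also have "\<dots> = ennreal (tail_prob P M t \<sigma> \<mu> b / c)"
    using \<open>0 < c\<close> by (simp add: tail_prob_def emeasure_eq_measure ennreal_mult'[symmetric])
  finally show ?thesis .
qed

section \<open>Choice of uniform constants and assembly of the bound\<close>

theorem proposition2:
  fixes \<mu>\<^sub>l \<mu>\<^sub>u \<sigma>\<^sub>l \<sigma>\<^sub>u \<beta> \<kappa>\<^sub>H a :: real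
    and g h :: "real \<Rightarrow> real \<Rightarrow> real"
    and M :: nat
    and t :: "nat \<Rightarrow> real ^ 'd"
    and W :: "'w measure"
    and f :: "real ^ 'd \<Rightarrow> 'w \<Rightarrow> real"
    and P :: "(nat \<Rightarrow> real) measure"
    and D :: "real \<Rightarrow> (nat \<Rightarrow> real) \<Rightarrow> ennreal"
    and Q :: "real \<Rightarrow> (nat \<Rightarrow> real) measure"
  defines "P \<equiv> field_law W f t M"
    and "D \<equiv> dQdP P M \<mu>\<^sub>l \<mu>\<^sub>u \<sigma>\<^sub>l \<sigma>\<^sub>u a g h"
    and "Q \<equiv> \<lambda>b. density P (D b)"
  assumes "\<mu>\<^sub>l \<le> \<mu>\<^sub>u" "0 < \<sigma>\<^sub>l" "\<sigma>\<^sub>l \<le> \<sigma>\<^sub>u" "0 < \<beta>" "0 < \<kappa>\<^sub>H" "0 < a"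
    and g: "\<And>b. 0 < b \<Longrightarrow> pos_cont_density \<sigma>\<^sub>l (\<sigma>\<^sub>u + (a / b)\<^sup>2) (g b)"
    and h: "\<And>b. 0 < b \<Longrightarrow> pos_cont_density \<mu>\<^sub>l (\<mu>\<^sub>u + a / b) (h b)"
    and g_low: "\<exists>c>0. \<forall>\<^sub>F b in at_top. \<forall>\<zeta>\<in>{\<sigma>\<^sub>l..\<sigma>\<^sub>u + (a / b)\<^sup>2}. c \<le> g b \<zeta>"
    and h_low: "\<exists>c>0. \<forall>\<^sub>F b in at_top. \<forall>\<nu>\<in>{\<mu>\<^sub>l..\<mu>\<^sub>u + a / b}. c \<le> h b \<nu>"
    and "1 \<le> M" "inj_on t {1..M}"
    and "gaussian_vector W {1..M} (\<lambda>i. f (t i))"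
    and "\<And>i. i \<in> {1..M} \<Longrightarrow> prob_space.expectation W (f (t i)) = 0"
    and "\<And>i. i \<in> {1..M} \<Longrightarrow> prob_space.variance W (f (t i)) = 1"
  shows "\<exists>b\<^sub>0 \<kappa>\<^sub>p :: real. \<forall>b\<ge>b\<^sub>0. \<forall>\<sigma> \<mu>.
           admissible \<mu>\<^sub>l \<mu>\<^sub>u \<sigma>\<^sub>l \<sigma>\<^sub>u \<kappa>\<^sub>H \<beta> (t ` {1..M}) \<sigma> \<mu> \<longrightarrow>
           (\<integral>\<^sup>+x. (estimator (D b) M t \<sigma> \<mu> b x)\<^sup>2 \<partial>Q b)
             / ennreal ((real M)\<^sup>2 * b ^ 6 * (tail_prob P M t \<sigma> \<mu> b)\<^sup>2) \<le> ennreal \<kappa>\<^sub>p"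
proof -
  obtain c\<^sub>g b\<^sub>1 where c\<^sub>g: "0 < c\<^sub>g"
    and g_ge: "\<And>b \<zeta>. b\<^sub>1 \<le> b \<Longrightarrow> \<zeta> \<in> {\<sigma>\<^sub>l..\<sigma>\<^sub>u + (a / b)\<^sup>2} \<Longrightarrow> c\<^sub>g \<le> g b \<zeta>"
    using g_low unfolding eventually_at_top_linorder by blast
  obtain c\<^sub>h b\<^sub>2 where c\<^sub>h: "0 < c\<^sub>h"
    and h_ge: "\<And>b \<nu>. b\<^sub>2 \<le> b \<Longrightarrow> \<nu> \<in> {\<mu>\<^sub>l..\<mu>\<^sub>u + a / b} \<Longrightarrow> c\<^sub>h \<le> h b \<nu>"
    using h_low unfolding eventually_at_top_linorder by blast
  note gaussian = \<open>gaussian_vector W {1..M} (\<lambda>i. f (t i))\<close>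
  have meas: "f (t i) \<in> borel_measurable W" if "i \<in> {1..M}" for i
    using gaussian that by (auto simp: gaussian_vector_def)
  have law: "distr W borel (f (t i)) = std_normal" if "i \<in> {1..M}" for i
    using gaussian_vector_marginal[OF gaussian that] assms that by simp
  have "prob_space W"
    using gaussian by (simp add: gaussian_vector_def)
  then interpret P: prob_space P
    unfolding P_def by (rule prob_space_field_law) (rule meas)
  have sets_P: "sets P = sets (\<Pi>\<^sub>M i\<in>{1..M}. borel)"
    by (simp add: P_def field_law_def)
  have coord: "(\<lambda>x. x i) \<in> borel_measurable P" if "i \<in> {1..M}" for i
    using measurable_component_singleton[OF that] by (simp cong: measurable_cong_sets add: sets_P)
  have tail: "measure P {y \<in> space P. b < \<zeta> * y i + \<nu>} = measure std_normal {(b - \<nu>) / \<zeta><..}"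
    if "i \<in> {1..M}" "0 < \<zeta>" for i b \<zeta> \<nu>
    unfolding P_def using measure_field_law_tail[where f=f and t=t] meas law that by blast
  define K where "K = 2 * a\<^sup>2 / \<sigma>\<^sub>l\<^sup>2 + a / \<sigma>\<^sub>l"
  define C where "C = 1 + exp (4 * K / \<sigma>\<^sub>l)"
  \<comment> \<open>Fixed before \<sigma> and \<mu>. The entries ensure, in order: b \<ge> 1, the
    lower bounds on g and h, \<bar>\<mu>\<bar> \<le> b for every admissible \<mu>, and the largeness
    condition of \<open>std_normal_tail_perturbed\<close> with S =
    \<open>\<sigma>\<^sub>u\<close>.\<close>
  define b\<^sub>0 where "b\<^sub>0 = Max {1, b\<^sub>1, b\<^sub>2, \<bar>\<mu>\<^sub>l\<bar>, \<bar>\<mu>\<^sub>u\<bar>, \<sigma>\<^sub>u * K + \<mu>\<^sub>u}"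
  \<comment> \<open>Chosen so that w / c equals \<kappa> M b^3 w^2 for the \<open>c\<close> defined
    below.\<close>
  define \<kappa> where "\<kappa> = C / (c\<^sub>g * c\<^sub>h * a ^ 3)"
  have "0 < C" by (simp add: C_def add_pos_pos)
  have "(\<integral>\<^sup>+x. (estimator (D b) M t \<sigma> \<mu> b x)\<^sup>2 \<partial>Q b)
      / ennreal ((real M)\<^sup>2 * b ^ 6 * (tail_prob P M t \<sigma> \<mu> b)\<^sup>2) \<le> ennreal \<kappa>"
    if "b\<^sub>0 \<le> b" and adm: "admissible \<mu>\<^sub>l \<mu>\<^sub>u \<sigma>\<^sub>l \<sigma>\<^sub>u \<kappa>\<^sub>H \<beta> (t ` {1..M}) \<sigma> \<mu>" for b \<sigma> \<mu>
  proof -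
    have b: "1 \<le> b" "b\<^sub>1 \<le> b" "b\<^sub>2 \<le> b" "\<bar>\<mu>\<^sub>l\<bar> \<le> b" "\<bar>\<mu>\<^sub>u\<bar> \<le> b" "\<sigma>\<^sub>u * K + \<mu>\<^sub>u \<le> b"
      using \<open>b\<^sub>0 \<le> b\<close> by (simp_all add: b\<^sub>0_def)
    have \<mu>: "\<mu>\<^sub>l \<le> \<mu> (t i)" "\<mu> (t i) \<le> \<mu>\<^sub>u" if "i \<in> {1..M}" for i
      using adm that by (auto simp: admissible_def)
    have \<sigma>: "\<sigma>\<^sub>l \<le> \<sigma> (t i)" "\<sigma> (t i) \<le> \<sigma>\<^sub>u" if "i \<in> {1..M}" for i
    proof -
      have "0 < \<sigma> (t i)" "\<sigma>\<^sub>l\<^sup>2 \<le> (\<sigma> (t i))\<^sup>2" "(\<sigma> (t i))\<^sup>2 \<le> \<sigma>\<^sub>u\<^sup>2"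
        using adm that by (auto simp: admissible_def)
      then show "\<sigma>\<^sub>l \<le> \<sigma> (t i)" "\<sigma> (t i) \<le> \<sigma>\<^sub>u"
        using assms by (auto intro: power2_le_imp_le)
    qed
    define w where "w = tail_prob P M t \<sigma> \<mu> b"
    have w_ge: "measure std_normal {(b - \<mu> (t i)) / \<sigma> (t i)<..} \<le> w" if "i \<in> {1..M}" for i
    proof -
      have event: "{x \<in> space P. exceeds M t \<sigma> \<mu> b x} \<in> sets P"
        unfolding exceeds_iff[OF \<open>1 \<le> M\<close>] using coord by measurable
      have "{y \<in> space P. b < \<sigma> (t i) * y i + \<mu> (t i)} \<subseteq> {x \<in> space P. exceeds M t \<sigma> \<mu> b x}"
        unfolding exceeds_iff[OF \<open>1 \<le> M\<close>] using that by blast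
      then have "measure P {y \<in> space P. b < \<sigma> (t i) * y i + \<mu> (t i)} \<le> w"
        unfolding w_def tail_prob_def using event by (rule P.finite_measure_mono)
      then show ?thesis
        using tail[OF that, of "\<sigma> (t i)"] \<sigma>[OF that] \<open>0 < \<sigma>\<^sub>l\<close> by simp
    qed
    have "0 < w"
      using w_ge[of 1] std_normal_tail_pos \<open>1 \<le> M\<close> by (auto intro: less_le_trans)
    define c where "c = c\<^sub>g * c\<^sub>h * (a / b) ^ 3 / (real M * (C * w))"
    have "0 < c"
      using c\<^sub>g c\<^sub>h assms b \<open>0 < C\<close> \<open>0 < w\<close> by (simp add: c_def)
    have low: "ennreal c \<le> D b x" if ex: "exceeds M t \<sigma> \<mu> b x" for x
    proof -
      obtain i where i: "i \<in> {1..M}" and x: "b < \<sigma> (t i) * x i + \<mu> (t i)"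
        using ex unfolding exceeds_iff[OF \<open>1 \<le> M\<close>] by blast
      have pos: "0 < \<sigma> (t i)"
        using \<sigma>[OF i] \<open>0 < \<sigma>\<^sub>l\<close> by simp
      \<comment> \<open>Since \<mu> (t i) is at most b, an exceedance forces a positive coordinate,
        as monotonicity in \<zeta> requires.\<close>
      have "0 < \<sigma> (t i) * x i"
        using x \<mu>[OF i] b by linarith
      then have xi: "0 \<le> x i"
        using pos by (simp add: zero_less_mult_iff)
      show ?thesis
        unfolding c_def D_def
      proof (rule dQdP_lower_bound[where i = i and s = "\<sigma> (t i)" and m = "\<mu> (t i)"])
        fix \<zeta> \<nu>
        assume \<zeta>: "\<zeta> \<in> {\<sigma> (t i)..\<sigma> (t i) + (a / b)\<^sup>2}" and \<nu>: "\<nu> \<in> {\<mu> (t i)..\<mu> (t i) + a / b}"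
        have "measure std_normal {(b - \<nu>) / \<zeta><..}
            \<le> C * measure std_normal {(b - \<mu> (t i)) / \<sigma> (t i)<..}"
          unfolding C_def
          by (rule std_normal_tail_perturbed[where S = \<sigma>\<^sub>u and a = a])
            (use \<zeta> \<nu> \<sigma>[OF i] \<mu>[OF i] b assms K_def in auto)
        also have "\<dots> \<le> C * w"
          using w_ge[OF i] \<open>0 < C\<close> by simp
        \<comment> \<open>The normaliser is read at coordinate 1 and the exceedance at
          \<open>i\<close>; equal marginals make both the same normal tail.\<close>
        finally show "measure P {y \<in> space P. b < \<zeta> * y 1 + \<nu>} \<in> {0<..C * w}"
          using tail[of 1 \<zeta> b \<nu>] \<zeta> pos \<open>1 \<le> M\<close> std_normal_tail_pos by simp
      qed (use i xi x assms b c\<^sub>g c\<^sub>h \<open>0 < C\<close> \<open>0 < w\<close> \<sigma>[OF i] \<mu>[OF i] g_ge h_ge in auto)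
    qed
    have "D b \<in> borel_measurable P"
      unfolding D_def using g h b \<open>1 \<le> M\<close> P.finite_measure_axioms sets_P
      by (intro borel_measurable_dQdP) auto
    then have "(\<integral>\<^sup>+x. (estimator (D b) M t \<sigma> \<mu> b x)\<^sup>2 \<partial>Q b) \<le> ennreal (w / c)"
      unfolding Q_def w_def using \<open>1 \<le> M\<close> \<open>0 < c\<close> coord low P.finite_measure_axioms
      by (intro second_moment_bound) auto
    also have "ennreal (w / c) \<le> ennreal (\<kappa> * ((real M)\<^sup>2 * b ^ 6 * w\<^sup>2))"
    proof (rule ennreal_leI)
      have "w / c = \<kappa> * (real M * b ^ 3 * w\<^sup>2)"
        using c\<^sub>g c\<^sub>h assms b \<open>0 < C\<close> \<open>0 < w\<close>
        by (simp add: c_def \<kappa>_def field_simps power2_eq_square)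
      \<comment> \<open>The argument yields the sharper order M b^3 w^2; M \<ge> 1 and b \<ge> 1
        relax it to the stated one.\<close>
      also have "\<dots> \<le> \<kappa> * ((real M)\<^sup>2 * b ^ 6 * w\<^sup>2)"
        using c\<^sub>g c\<^sub>h \<open>0 < a\<close> b \<open>0 < C\<close> \<open>1 \<le> M\<close>
        by (intro mult_left_mono mult_right_mono mult_mono power_increasing)
          (auto simp: \<kappa>_def self_le_power)
      finally show "w / c \<le> \<kappa> * ((real M)\<^sup>2 * b ^ 6 * w\<^sup>2)" .
    qed
    finally have "(\<integral>\<^sup>+x. (estimator (D b) M t \<sigma> \<mu> b x)\<^sup>2 \<partial>Q b)
        \<le> ennreal \<kappa> * ennreal ((real M)\<^sup>2 * b ^ 6 * w\<^sup>2)"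
      using c\<^sub>g c\<^sub>h \<open>0 < a\<close> \<open>0 < C\<close> by (subst ennreal_mult'[symmetric]) (simp_all add: \<kappa>_def)
    moreover have "0 < (real M)\<^sup>2 * b ^ 6 * w\<^sup>2"
      using \<open>1 \<le> M\<close> b \<open>0 < w\<close> by simp
    ultimately show ?thesis
      unfolding w_def[symmetric]
      by (intro divide_le_posI_ennreal) (auto simp: mult.commute)
  qed
  then show ?thesis
    by blast
qed

end
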